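(* Let $\mathcal{M}$ be either the minority process or the majority process. A tree $T$ with $n$ nodes, diameter $D$ and maximal node degree $\Delta$ has at least $\max\left(2^{r/2+1}, 2F_D\right)$ and at most $\min\left(2^{n-\Delta}, 2F_{n-\lceil \Delta/2\rceil}\right)$ fixed points of $\mathcal{M}$, where $r$ is the number of inner nodes (nodes of degree at least $2$) of the tree $T_L$ obtained from $T$ by removing all leaves of $T$.
   Context: Let $T=(V,E)$ be a finite undirected tree. A coloring is a map $c:V\to\{0,1\}$. For a node $v$ and $i\in\{0,1\}$ let $N^i(v)$ be the set of neighbors $u$ of $v$ with $c(u)=i$. The minority process maps $c$ to $\mathcal{MIN}(c)$, where $\mathcal{MIN}(c)(v)=c(v)$ if $|N^{c(v)}(v)|\le |N^{1-c(v)}(v)|$ and $\mathcal{MIN}(c)(v)=1-c(v)$ otherwise, simultaneously for all $v$. The majority process $\mathcal{MAJ}$ is defined with the comparisons reversed: $\mathcal{MAJ}(c)(v)=c(v)$ if $|N^{c(v)}(v)|\ge |N^{1-c(v)}(v)|$ and $1-c(v)$ otherwise. A fixed point of $\mathcal{M}$ is a coloring $c$ with $\mathcal{M}(c)=c$. $F_i$ denotes the $i$-th Fibonacci number: $F_0=0$, $F_1=1$, $F_i=F_{i-1}+F_{i-2}$. *)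

theory Defs
  imports "Graph_Theory.Graph_Theory" "HOL-Number_Theory.Fib"
begin

text \<open>
  A finite simple undirected graph is a symmetric, loop-free digraph without parallel arcs
  (locale \<^locale>\<open>graph\<close>): each undirected edge is a pair of opposite arcs.  In such a digraph
  \<open>out_degree G v\<close> is the number of neighbors of \<open>v\<close>.

  The library predicate \<^const>\<open>tree\<close> is not usable here: traversing an edge back and forth
  counts as a cycle of length 2, so no symmetric digraph with an edge satisfies it.  Since
  there are no loops and no parallel arcs, the cycles of the undirected graph are exactly the
  cycles of length at least 3.
\<close>

definition undirected_tree :: "('a, 'b) pre_digraph \<Rightarrow> bool" where
  "undirected_tree G \<longleftrightarrow>
     graph G \<and> connected G \<and> \<not> (\<exists>p. pre_digraph.cycle G p \<and> 3 \<le> length p)"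

definition distance :: "('a, 'b) pre_digraph \<Rightarrow> 'a \<Rightarrow> 'a \<Rightarrow> nat" where
  "distance G u v = (LEAST k. \<exists>p. pre_digraph.awalk G u p v \<and> length p = k)"

definition diameter :: "('a, 'b) pre_digraph \<Rightarrow> nat" where
  "diameter G = Max {distance G u v | u v. u \<in> verts G \<and> v \<in> verts G}"

definition max_degree :: "('a, 'b) pre_digraph \<Rightarrow> nat" where
  "max_degree G = Max (out_degree G ` verts G)"

definition leaves :: "('a, 'b) pre_digraph \<Rightarrow> 'a set" where
  "leaves G = {v \<in> verts G. out_degree G v = 1}"

definition inner_nodes :: "('a, 'b) pre_digraph \<Rightarrow> 'a set" where
  "inner_nodes G = {v \<in> verts G. 2 \<le> out_degree G v}"

definition remove_leaves :: "('a, 'b) pre_digraph \<Rightarrow> ('a, 'b) pre_digraph" where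
  "remove_leaves G = G \<restriction> (verts G - leaves G)"

text \<open>
  Colorings are extensional functions, so that they are determined by their values on the
  vertices and the number of colorings is meaningful.
\<close>

definition colorings :: "('a, 'b) pre_digraph \<Rightarrow> ('a \<Rightarrow> nat) set" where
  "colorings G = verts G \<rightarrow>\<^sub>E {0, 1}"

definition colored_neighbors ::
    "('a, 'b) pre_digraph \<Rightarrow> ('a \<Rightarrow> nat) \<Rightarrow> nat \<Rightarrow> 'a \<Rightarrow> 'a set" where
  "colored_neighbors G c i v = {u \<in> verts G. v \<rightarrow>\<^bsub>G\<^esub> u \<and> c u = i}"

definition minority :: "('a, 'b) pre_digraph \<Rightarrow> ('a \<Rightarrow> nat) \<Rightarrow> ('a \<Rightarrow> nat)" where
  "minority G c = (\<lambda>v\<in>verts G.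
     if card (colored_neighbors G c (c v) v) \<le> card (colored_neighbors G c (1 - c v) v)
     then c v else 1 - c v)"

definition majority :: "('a, 'b) pre_digraph \<Rightarrow> ('a \<Rightarrow> nat) \<Rightarrow> ('a \<Rightarrow> nat)" where
  "majority G c = (\<lambda>v\<in>verts G.
     if card (colored_neighbors G c (c v) v) \<ge> card (colored_neighbors G c (1 - c v) v)
     then c v else 1 - c v)"

definition fixed_points ::
    "('a, 'b) pre_digraph \<Rightarrow> (('a \<Rightarrow> nat) \<Rightarrow> ('a \<Rightarrow> nat)) \<Rightarrow> ('a \<Rightarrow> nat) set" where
  "fixed_points G M = {c \<in> colorings G. M c = c}"

end

theory Submission
  imports Defs
begin

text \<open>
  Root the tree at \<open>x\<close>. A coloring is determined by the color of the root together with the set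
  \<open>F\<close> of edges that are monochromatic (minority) or bichromatic (majority), and it is a fixed
  point iff every vertex is incident to at most half of its degree many edges of \<open>F\<close>. So there
  are twice as many fixed points as legal edge sets \<open>F\<close>.

  Upper bounds: take for \<open>x\<close> a vertex of maximal degree. It suffices that at most
  \<open>k = \<lfloor>\<Delta>/2\<rfloor>\<close> edges at \<open>x\<close> are selected and that no other vertex has all of its edges
  selected. Cutting the tree at an edge \<open>x y\<close> and distinguishing whether this edge is selected
  gives the bounds \<open>F\<^bsub>k+n-\<Delta>\<^esub>\<close> and \<open>2\<^bsup>n-1-\<Delta>\<^esup>\<close> by induction; for the former
  the inductive step is exactly the addition theorem for Fibonacci numbers.

  Lower bounds: every matching that avoids the leaves is legal. Matchings in the
  interior of a longest path yield \<open>F\<^sub>D\<close>, and the subsets of a single matching with at least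
  \<open>r/2\<close> edges yield \<open>2\<^bsup>r/2\<^esup>\<close>.
\<close>

section \<open>Counting edge sets in rooted trees\<close>

text \<open>Strict growth of \<open>d\<close> away from the root makes the parent map acyclic. Only
  increments of \<open>d\<close> are prescribed, so a subtree rooted at a child keeps the same
  \<open>p\<close> and \<open>d\<close>.\<close>

locale rooted_tree =
  fixes V :: "'a set" and x :: 'a and p :: "'a \<Rightarrow> 'a" and d :: "'a \<Rightarrow> nat"
  assumes finite_V: "finite V"
    and root_in: "x \<in> V"
    and parent_in: "v \<in> V - {x} \<Longrightarrow> p v \<in> V"
    and depth_parent: "v \<in> V - {x} \<Longrightarrow> d v = Suc (d (p v))"

text \<open>Vertex set and root are explicit arguments because children are compared across the
  parts of a cut tree. The root is left out since its value under \<open>p\<close> is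
  arbitrary.\<close>

definition children :: "'a set \<Rightarrow> 'a \<Rightarrow> ('a \<Rightarrow> 'a) \<Rightarrow> 'a \<Rightarrow> 'a set" where
  "children V x p v = {u \<in> V - {x}. p u = v}"

lemma children_subset: "children V x p v \<subseteq> V - {x}"
  by (auto simp: children_def)

context rooted_tree
begin

lemma finite_children: "finite (children V x p v)"
  by (rule finite_subset[OF children_subset]) (simp add: finite_V)

lemma card_children_root_less: "card (children V x p x) < card V"
  using children_subset[of V x p x] root_in by (intro psubset_card_mono finite_V) auto

text \<open>A non-root vertex of least depth has a parent of smaller depth, which can only be the
  root.\<close>

lemma root_has_child:
  assumes "V \<noteq> {x}"
  shows "children V x p x \<noteq> {}"
proof -
  have "V - {x} \<noteq> {}"
    using assms root_in by auto
  then obtain v where v: "v \<in> V - {x}" "\<And>u. u \<in> V - {x} \<Longrightarrow> d v \<le> d u"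
    using ex_has_least_nat[of "\<lambda>v. v \<in> V - {x}" _ d] by blast
  have "p v = x"
    using v(2)[of "p v"] parent_in[OF v(1)] depth_parent[OF v(1)] by auto
  then show ?thesis
    using v(1) by (auto simp: children_def)
qed

text \<open>\<open>B\<close> consists of \<open>y\<close> and its descendants. It is closed under
  children, and under parents except at \<open>y\<close>, so cutting the edge above \<open>y\<close>
  changes the children of \<open>x\<close> only.\<close>

lemma split_off_child:
  assumes y: "y \<in> children V x p x"
  obtains A B where "A \<union> B = V" "A \<inter> B = {}" "x \<in> A" "y \<in> B"
    "rooted_tree A x p d" "rooted_tree B y p d"
    "children V x p x = insert y (children A x p x)"
    "\<And>v. v \<in> A - {x} \<Longrightarrow> children V x p v = children A x p v"
    "\<And>v. v \<in> B \<Longrightarrow> children V x p v = children B y p v"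
proof -
  define R where "R = {(v, p v) | v. v \<in> V - {x}}"
  define B where "B = {v \<in> V. (v, y) \<in> R\<^sup>*}"
  define A where "A = V - B"
  have yV: "y \<in> V" "y \<noteq> x" and py: "p y = x"
    using y by (auto simp: children_def)
  have "B \<subseteq> V"
    by (auto simp: B_def)
  have xB: "x \<notin> B"
    using yV by (auto simp: B_def R_def elim: converse_rtranclE)
  have yB: "y \<in> B"
    using yV by (simp add: B_def)
  have up: "v \<in> B" if "v \<in> V - {x}" "p v \<in> B" for v
    using that by (auto simp: B_def R_def intro: converse_rtrancl_into_rtrancl)
  have down: "p v \<in> B" if "v \<in> B" "v \<noteq> y" for v
    using that parent_in by (auto simp: B_def R_def elim: converse_rtranclE)
  show ?thesis
  proof
    show "A \<union> B = V" "A \<inter> B = {}" "x \<in> A" "y \<in> B"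
      using xB yB root_in by (auto simp: A_def B_def)
    show "rooted_tree A x p d"
      by unfold_locales (use finite_V root_in xB up parent_in depth_parent in \<open>auto simp: A_def\<close>)
    show "rooted_tree B y p d"
      using finite_V yB down depth_parent xB by unfold_locales (auto simp: B_def)
    show "children V x p x = insert y (children A x p x)"
      unfolding A_def children_def using xB yV py down by blast
    show "children V x p v = children A x p v" if "v \<in> A - {x}" for v
      unfolding A_def children_def using that down up py xB unfolding A_def by blast
    show "children V x p v = children B y p v" if "v \<in> B" for v
      using that down up py xB yV \<open>B \<subseteq> V\<close> unfolding children_def by blast
  qed
qed

end

text \<open>
  An edge set is encoded by the set of the lower endpoints of its edges. This weakening of the
  fixed point condition, with an arbitrary budget \<open>k\<close> at the root, is inherited by both parts
  when the tree is cut at an edge below the root.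
\<close>

definition relaxed :: "'a set \<Rightarrow> 'a \<Rightarrow> ('a \<Rightarrow> 'a) \<Rightarrow> nat \<Rightarrow> 'a set set" where
  "relaxed V x p k = {F. F \<subseteq> V - {x} \<and> card (F \<inter> children V x p x) \<le> k
     \<and> (\<forall>v\<in>V - {x}. v \<in> F \<longrightarrow> \<not> children V x p v \<subseteq> F)}"

lemma finite_relaxed: "finite V \<Longrightarrow> finite (relaxed V x p k)"
  by (rule finite_subset[of _ "Pow V"]) (auto simp: relaxed_def)

text \<open>The Fibonacci addition theorem, shifted so that its two products match the cut edge
  being unselected and selected.\<close>

lemma fib_split: "0 < n \<Longrightarrow> fib (m + n) = fib (Suc m) * fib n + fib m * fib (n - 1)"
  using fib_add[of "n - 1" m] by (simp add: add.commute mult.commute)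

text \<open>Restrict \<open>F\<close> to both sides of the cut. If the cut edge is unselected, the
  budget at \<open>x\<close> stays \<open>k\<close> and the budget \<open>m\<close> at
  \<open>y\<close> is no constraint. If it is selected, \<open>x\<close> has \<open>k - 1\<close>
  left and \<open>y\<close> must keep an unselected child, which leaves
  \<open>m - 1\<close>.\<close>

lemma card_relaxed_split:
  assumes A: "rooted_tree A x p d" and B: "rooted_tree B y p d"
    and AB: "A \<union> B = V" "A \<inter> B = {}" "x \<in> A" "y \<in> B"
    and chx: "children V x p x = insert y (children A x p x)"
    and chA: "\<And>v. v \<in> A - {x} \<Longrightarrow> children V x p v = children A x p v"
    and chB: "\<And>v. v \<in> B \<Longrightarrow> children V x p v = children B y p v"
  defines "m \<equiv> card (children B y p y)"
  shows "card (relaxed V x p k) \<le> card (relaxed A x p k) * card (relaxed B y p m)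
     + (if k = 0 \<or> m = 0 then 0
        else card (relaxed A x p (k - 1)) * card (relaxed B y p (m - 1)))"
proof -
  interpret A: rooted_tree A x p d by fact
  interpret B: rooted_tree B y p d by fact
  define P where "P = relaxed A x p k \<times> relaxed B y p m"
  \<comment> \<open>The cut edge cannot be selected if the budget is 0, nor if \<open>y\<close> is a
    leaf, whose only edge it is.\<close>
  define Q where "Q = (if k = 0 \<or> m = 0 then {}
    else relaxed A x p (k - 1) \<times> relaxed B y p (m - 1))"
  have fin: "finite P" "finite Q"
    using finite_relaxed[OF A.finite_V] finite_relaxed[OF B.finite_V] by (auto simp: P_def Q_def)
  \<comment> \<open>As root of \<open>B\<close>, \<open>y\<close> may not occur in the last
    component; the flag in the first keeps the map injective.\<close>
  let ?f = "\<lambda>F. (y \<in> F, F \<inter> A, F \<inter> B - {y})"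
  have chA_sub: "children A x p v \<subseteq> A" "y \<notin> children A x p v" for v
    using AB(2,4) children_subset[of A x p v] by auto
  have mem: "?f F \<in> {False} \<times> P \<union> {True} \<times> Q" if F: "F \<in> relaxed V x p k" for F
  proof -
    have FV: "F \<subseteq> V - {x}" and Fk: "card (F \<inter> children V x p x) \<le> k"
      and Fv: "\<And>v. v \<in> V - {x} \<Longrightarrow> v \<in> F \<Longrightarrow> \<not> children V x p v \<subseteq> F"
      using F by (auto simp: relaxed_def)
    have cardA: "card (F \<inter> children V x p x)
        = card (F \<inter> A \<inter> children A x p x) + (if y \<in> F then 1 else 0)"
    proof -
      have "F \<inter> children V x p x = (F \<inter> A \<inter> children A x p x) \<union> (if y \<in> F then {y} else {})"
        using chA_sub chx by auto
      then show ?thesis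
        using chA_sub A.finite_children[of x] by (auto simp: card_insert_if)
    qed
    have leA: "F \<inter> A \<in> relaxed A x p j" if "card (F \<inter> A \<inter> children A x p x) \<le> j" for j
      unfolding relaxed_def using that FV Fv chA chA_sub AB by blast
    have leB: "F \<inter> B - {y} \<in> relaxed B y p j"
      if "card ((F \<inter> B - {y}) \<inter> children B y p y) \<le> j" for j
    proof -
      have "\<not> children B y p v \<subseteq> F \<inter> B - {y}" if "v \<in> B - {y}" "v \<in> F \<inter> B - {y}" for v
        using that Fv[of v] chB[of v] AB by auto
      then show ?thesis
        using that by (auto simp: relaxed_def)
    qed
    show ?thesis
    proof (cases "y \<in> F")
      case False
      have "card ((F \<inter> B - {y}) \<inter> children B y p y) \<le> m"
        unfolding m_def by (intro card_mono B.finite_children) auto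
      then show ?thesis
        using False leA[of k] leB[of m] cardA Fk by (auto simp: P_def)
    next
      case True
      then have "\<not> children B y p y \<subseteq> F"
        using Fv[of y] chB[of y] AB by auto
      then have "card ((F \<inter> B - {y}) \<inter> children B y p y) < m"
        unfolding m_def by (intro psubset_card_mono B.finite_children) auto
      then show ?thesis
        using True leA[of "k - 1"] leB[of "m - 1"] cardA Fk by (auto simp: Q_def)
    qed
  qed
  have "inj_on ?f (relaxed V x p k)"
  proof (rule inj_onI)
    fix F F' assume "F \<in> relaxed V x p k" "F' \<in> relaxed V x p k" and eq: "?f F = ?f F'"
    then have "F \<subseteq> A \<union> B" "F' \<subseteq> A \<union> B"
      using AB(1) by (auto simp: relaxed_def)
    moreover have "z \<in> F \<longleftrightarrow> z \<in> F'" if "z \<in> A \<union> B" for z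
      using eq that by (cases "z = y") blast+
    ultimately show "F = F'" by blast
  qed
  then have "card (relaxed V x p k) \<le> card ({False} \<times> P \<union> {True} \<times> Q)"
    using mem fin by (intro card_inj_on_le[where f = ?f]) auto
  also have "\<dots> = card P + card Q"
    using fin by (subst card_Un_disjoint) auto
  finally show ?thesis
    by (cases "k = 0 \<or> m = 0") (simp_all add: P_def Q_def card_cartesian_product)
qed

text \<open>Induction on the size of the tree, cutting off one child of the root. The budget is
  general because both parts are used with two different budgets.\<close>

lemma card_relaxed_bounds:
  assumes "rooted_tree V x p d"
  shows "card (relaxed V x p k) \<le> fib (k + card V - card (children V x p x))
    \<and> card (relaxed V x p k) \<le> 2 ^ (card V - 1 - card (children V x p x))"
  using assms
proof (induction "card V" arbitrary: V x k rule: less_induct)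
  case less
  interpret rooted_tree V x p d by fact
  show ?case
  proof (cases "V = {x}")
    case True
    then have "relaxed V x p k \<subseteq> {{}}"
      by (auto simp: relaxed_def)
    then have "card (relaxed V x p k) \<le> 1"
      using card_mono[of "{{}}" "relaxed V x p k"] by simp
    moreover have "children V x p x = {}"
      using True by (auto simp: children_def)
    moreover have "1 \<le> fib (Suc k)"
      using fib_neq_0_nat[of "Suc k"] by linarith
    ultimately show ?thesis
      using True by auto
  next
    case False
    then obtain y where y: "y \<in> children V x p x"
      using root_has_child by blast
    obtain A B where AB: "A \<union> B = V" "A \<inter> B = {}" "x \<in> A" "y \<in> B"
      and A: "rooted_tree A x p d" and B: "rooted_tree B y p d"
      and ch: "children V x p x = insert y (children A x p x)"
        "\<And>v. v \<in> A - {x} \<Longrightarrow> children V x p v = children A x p v"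
        "\<And>v. v \<in> B \<Longrightarrow> children V x p v = children B y p v"
      using split_off_child[OF y] by blast
    interpret A: rooted_tree A x p d by fact
    interpret B: rooted_tree B y p d by fact
    \<comment> \<open>After the cut, \<open>card V\<close> minus the number of children of
      \<open>x\<close> becomes \<open>a + b - 1\<close>.\<close>
    define a where "a = card A - card (children A x p x)"
    define b where "b = card B"
    define m where "m = card (children B y p y)"
    have a: "0 < a" and cA: "card A = a + card (children A x p x)"
      using A.card_children_root_less by (auto simp: a_def)
    have b: "m < b"
      using B.card_children_root_less by (simp add: m_def b_def)
    have cV: "card V = card A + b"
      using card_Un_disjoint[OF A.finite_V B.finite_V AB(2)] AB(1) by (simp add: b_def)
    have "y \<notin> children A x p x"
      using AB(2,4) children_subset[of A x p x] by auto
    then have chV: "card (children V x p x) = Suc (card (children A x p x))"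
      using ch(1) A.finite_children by simp
    have lt: "card A < card V" "card B < card V"
      using cV b a cA by (auto simp: b_def)
    have IHA: "card (relaxed A x p j) \<le> fib (j + a)" "card (relaxed A x p j) \<le> 2 ^ (a - 1)" for j
      using less(1)[OF lt(1) A, of j] a by (auto simp: cA)
    have IHB: "card (relaxed B y p j) \<le> fib (j + b - m)"
      "card (relaxed B y p j) \<le> 2 ^ (b - 1 - m)" for j
      using less(1)[OF lt(2) B, of j] by (auto simp: b_def m_def)
    note split = card_relaxed_split[OF A B AB ch, of k, folded m_def]
    \<comment> \<open>With budgets \<open>m\<close> and \<open>m - 1\<close> at \<open>y\<close>,
      the index \<open>j + b - m\<close> becomes \<open>b\<close> and \<open>b - 1\<close>.\<close>
    have "card (relaxed V x p k) \<le> fib (k + a) * fib b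
        + (if k = 0 \<or> m = 0 then 0 else fib (k - 1 + a) * fib (b - 1))"
      using IHB(1)[of m] IHB(1)[of "m - 1"] IHA(1)[of k] IHA(1)[of "k - 1"]
      by (intro order.trans[OF split] add_mono)
        (auto intro!: mult_mono simp del: One_nat_def)
    also have "\<dots> \<le> fib (k + a) * fib b + fib (k + a - 1) * fib (b - 1)"
      using a by (auto simp: gr0_conv_Suc)
    also have "\<dots> = fib (k + a - 1 + b)"
      using fib_split[of b "k + a - 1"] a b by simp
    also have "k + a - 1 + b = k + card V - card (children V x p x)"
      using a by (simp add: cV cA chV)
    finally have fib_bound:
      "card (relaxed V x p k) \<le> fib (k + card V - card (children V x p x))" .
    have "card (relaxed V x p k) \<le> 2 ^ (a - 1) * 2 ^ (b - 1 - m)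
        + (if k = 0 \<or> m = 0 then 0 else 2 ^ (a - 1) * 2 ^ (b - 1 - m))"
      using IHB(2)[of m] IHB(2)[of "m - 1"] IHA(2)[of k] IHA(2)[of "k - 1"]
      by (intro order.trans[OF split] add_mono)
        (auto intro!: mult_mono simp del: One_nat_def)
    \<comment> \<open>The second summand occurs only for positive \<open>m\<close>, and then the
      exponent \<open>b - 1 - m\<close> leaves room for the doubling.\<close>
    also have "\<dots> \<le> 2 ^ (a - 1) * 2 ^ (b - 1)"
    proof (cases m)
      case (Suc l)
      then have "(2::nat) * 2 ^ (b - 1 - m) \<le> 2 ^ (b - 1)"
        using b power_increasing[of "Suc (b - 1 - m)" "b - 1" "2 :: nat"] by simp
      then have "(2::nat) ^ (a - 1) * (2 * 2 ^ (b - 1 - m)) \<le> 2 ^ (a - 1) * 2 ^ (b - 1)"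
        by (rule mult_left_mono) simp
      then show ?thesis
        using Suc by (auto simp: mult_2 add_mult_distrib2 simp del: One_nat_def)
    qed simp
    also have "\<dots> = 2 ^ (card V - 1 - card (children V x p x))"
      using a b by (simp add: cV cA chV flip: power_add)
    finally show ?thesis
      using fib_bound by blast
  qed
qed

section \<open>Legal edge sets and colorings\<close>

text \<open>The selected edges at \<open>v\<close> lead to its selected children and, if
  \<open>v \<in> F\<close>, to its parent; the right-hand side is the degree of
  \<open>v\<close>.\<close>

definition legal :: "'a set \<Rightarrow> 'a \<Rightarrow> ('a \<Rightarrow> 'a) \<Rightarrow> 'a set set" where
  "legal V x p = {F. F \<subseteq> V - {x} \<and> (\<forall>v\<in>V.
     2 * (card (F \<inter> children V x p v) + of_bool (v \<in> F))
       \<le> card (children V x p v) + of_bool (v \<noteq> x))}"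

definition neighbors :: "'a set \<Rightarrow> 'a \<Rightarrow> ('a \<Rightarrow> 'a) \<Rightarrow> 'a \<Rightarrow> 'a set" where
  "neighbors V x p v = children V x p v \<union> (if v = x then {} else {p v})"

context rooted_tree
begin

lemma parent_notin_children: "v \<in> V - {x} \<Longrightarrow> p v \<notin> children V x p v"
  using depth_parent[of v] depth_parent[of "p v"] by (auto simp: children_def)

lemma finite_neighbors: "finite (neighbors V x p v)"
  by (simp add: neighbors_def finite_children)

lemma card_neighbors:
  "v \<in> V \<Longrightarrow> card (neighbors V x p v) = card (children V x p v) + of_bool (v \<noteq> x)"
  using parent_notin_children[of v] finite_children[of v] by (simp add: neighbors_def)

lemma legal_subset: "legal V x p \<subseteq> Pow (V - {x})"
  by (auto simp: legal_def)

lemma finite_legal: "finite (legal V x p)"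
  by (rule finite_subset[OF legal_subset]) (simp add: finite_V)

text \<open>Legality implies the relaxed condition: a non-root vertex has positive degree, so at
  most half of its edges cannot be all of them.\<close>

lemma card_legal_le:
  defines "\<Delta> \<equiv> card (children V x p x)"
  shows "card (legal V x p) \<le> fib (card V - (\<Delta> - \<Delta> div 2))"
    and "card (legal V x p) \<le> 2 ^ (card V - 1 - \<Delta>)"
proof -
  have "legal V x p \<subseteq> relaxed V x p (\<Delta> div 2)"
  proof
    fix F assume F: "F \<in> legal V x p"
    have "\<not> children V x p v \<subseteq> F" if "v \<in> V - {x}" "v \<in> F" for v
    proof
      assume "children V x p v \<subseteq> F"
      then have "F \<inter> children V x p v = children V x p v"
        by auto
      then show False
        using F that by (auto simp: legal_def)
    qed
    moreover have "card (F \<inter> children V x p x) \<le> \<Delta> div 2"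
      using F root_in by (auto simp: legal_def \<Delta>_def)
    ultimately show "F \<in> relaxed V x p (\<Delta> div 2)"
      using F by (auto simp: relaxed_def legal_def)
  qed
  then have "card (legal V x p) \<le> card (relaxed V x p (\<Delta> div 2))"
    by (intro card_mono finite_relaxed finite_V)
  \<comment> \<open>\<open>\<Delta> - \<Delta> div 2\<close> is half of \<open>\<Delta>\<close>
    rounded up.\<close>
  moreover have "\<Delta> div 2 + card V - \<Delta> = card V - (\<Delta> - \<Delta> div 2)"
    using card_children_root_less by (simp add: \<Delta>_def)
  ultimately show "card (legal V x p) \<le> fib (card V - (\<Delta> - \<Delta> div 2))"
    "card (legal V x p) \<le> 2 ^ (card V - 1 - \<Delta>)"
    using card_relaxed_bounds[OF rooted_tree_axioms, of "\<Delta> div 2", folded \<Delta>_def]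
    by (auto intro: order.trans)
qed

text \<open>Injectivity of \<open>p\<close> forbids two edges with a common upper end, and
  \<open>disj\<close> forbids one edge continuing another. So each vertex meets at most one selected
  edge, which degree 2 allows.\<close>

lemma matching_legal:
  assumes F: "F \<subseteq> V - {x}" and inj: "inj_on p F" and disj: "\<And>v. v \<in> F \<Longrightarrow> p v \<notin> F"
    and deg: "\<And>v. v \<in> F \<Longrightarrow> 2 \<le> card (neighbors V x p v) \<and> 2 \<le> card (neighbors V x p (p v))"
  shows "F \<in> legal V x p"
proof -
  have "2 * (card (F \<inter> children V x p v) + of_bool (v \<in> F)) \<le> card (neighbors V x p v)"
    if v: "v \<in> V" for v
  proof (cases "F \<inter> children V x p v = {}")
    case True
    then show ?thesis using deg by auto
  next
    case False
    then obtain u where u: "u \<in> F" "p u = v"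
      by (auto simp: children_def)
    have "F \<inter> children V x p v = {u}"
      using False u inj by (auto simp: children_def dest: inj_onD)
    moreover have "v \<notin> F" "2 \<le> card (neighbors V x p v)"
      using u disj[of u] deg[of u] by auto
    ultimately show ?thesis by simp
  qed
  then show ?thesis
    using F by (simp add: legal_def card_neighbors)
qed

text \<open>Agreement spreads from the root downwards, by induction on the depth.\<close>

lemma coloring_eqI:
  assumes "c \<in> V \<rightarrow>\<^sub>E S" "c' \<in> V \<rightarrow>\<^sub>E S" "c x = c' x"
    and "\<And>v. v \<in> V - {x} \<Longrightarrow> c (p v) = c' (p v) \<Longrightarrow> c v = c' v"
  shows "c = c'"
proof (rule PiE_ext[OF assms(1,2)])
  fix v assume "v \<in> V"
  then show "c v = c' v"
  proof (induction "d v" arbitrary: v rule: less_induct)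
    case less
    then show ?case
      using assms(3,4) depth_parent[of v] parent_in[of v] by (cases "v = x") auto
  qed
qed

text \<open>
  \<open>R\<close> is the relation between the colors of the endpoints of an edge that a vertex wants to
  avoid: equality for the minority process, inequality for the majority process.
\<close>

lemma bij_betw_colorings:
  fixes R :: "nat \<Rightarrow> nat \<Rightarrow> bool"
  assumes R: "R = (=) \<or> R = (\<noteq>)"
  shows "bij_betw (\<lambda>c. (c x, {v \<in> V - {x}. R (c v) (c (p v))}))
    (V \<rightarrow>\<^sub>E {0, 1}) ({0, 1} \<times> Pow (V - {x}))"
    (is "bij_betw ?f ?C ?E")
proof -
  have inj: "inj_on ?f ?C"
  proof (rule inj_onI)
    fix c c' assume c: "c \<in> ?C" "c' \<in> ?C" and eq: "?f c = ?f c'"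
    show "c = c'"
    proof (rule coloring_eqI[OF c])
      show "c x = c' x"
        using eq by simp
      fix v assume v: "v \<in> V - {x}" and pv: "c (p v) = c' (p v)"
      have "R (c v) (c (p v)) \<longleftrightarrow> R (c' v) (c' (p v))"
        using eq v by blast
      moreover have "c v \<in> {0, 1}" "c' v \<in> {0, 1}" "c' (p v) \<in> {0, 1}"
        using c v parent_in[OF v] by (blast dest: PiE_mem)+
      ultimately show "c v = c' v"
        using R by (elim disjE) (simp, auto simp: pv)
    qed
  qed
  \<comment> \<open>Surjectivity follows by counting: both sides are finite with
    \<open>2 ^ card V\<close> elements.\<close>
  have "card V = Suc (card (V - {x}))"
    using card.remove[OF finite_V root_in] .
  then have "card ?C = card ?E"
    using finite_V by (simp add: card_PiE card_cartesian_product card_Pow numeral_2_eq_2)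
  then have card: "card (?f ` ?C) = card ?E"
    using card_image[OF inj] by (rule trans[rotated])
  have sub: "?f ` ?C \<subseteq> ?E"
  proof (rule image_subsetI)
    fix c assume "c \<in> ?C"
    then have "c x \<in> {0, 1}"
      using root_in by (rule PiE_mem)
    then show "?f c \<in> ?E"
      by blast
  qed
  have "finite ?E"
    using finite_V by simp
  then have "?f ` ?C = ?E"
    using sub card by (rule card_subset_eq)
  with inj show ?thesis
    by (simp add: bij_betw_def)
qed

text \<open>Under the bijection, the neighbors that \<open>v\<close> wants to avoid correspond to
  the selected edges at \<open>v\<close>, so stable colorings match legal sets; the root color
  contributes the factor 2.\<close>

lemma card_stable_colorings:
  fixes R :: "nat \<Rightarrow> nat \<Rightarrow> bool"
  assumes R: "R = (=) \<or> R = (\<noteq>)"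
  shows "card {c \<in> V \<rightarrow>\<^sub>E {0, 1}. \<forall>v\<in>V.
      2 * card {u \<in> neighbors V x p v. R (c u) (c v)} \<le> card (neighbors V x p v)}
    = 2 * card (legal V x p)"
proof -
  let ?E = "\<lambda>c. {v \<in> V - {x}. R (c v) (c (p v))}"
  let ?f = "\<lambda>c. (c x, ?E c)"
  let ?stable = "\<lambda>c. \<forall>v\<in>V.
    2 * card {u \<in> neighbors V x p v. R (c u) (c v)} \<le> card (neighbors V x p v)"
  have "card {u \<in> neighbors V x p v. R (c u) (c v)}
      = card (?E c \<inter> children V x p v) + of_bool (v \<in> ?E c)" if v: "v \<in> V" for c v
  proof -
    have "{u \<in> neighbors V x p v. R (c u) (c v)}
        = (?E c \<inter> children V x p v) \<union> (if v \<in> ?E c then {p v} else {})"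
      \<comment> \<open>For the parent, the arguments of \<open>R\<close> are swapped; both choices
        of \<open>R\<close> are symmetric.\<close>
      using v R by (auto simp: neighbors_def children_def)
    then show ?thesis
      using parent_notin_children[of v] finite_children[of v] v by auto
  qed
  then have stable: "?stable c \<longleftrightarrow> ?E c \<in> legal V x p" for c
    by (auto simp: legal_def card_neighbors)
  let ?S = "{c \<in> V \<rightarrow>\<^sub>E {0, 1}. ?stable c}"
  have im: "?f ` (V \<rightarrow>\<^sub>E {0, 1}) = {0, 1} \<times> Pow (V - {x})"
    using bij_betw_colorings[OF R] by (simp add: bij_betw_def)
  have "?f ` ?S = {q \<in> ?f ` (V \<rightarrow>\<^sub>E {0, 1}). snd q \<in> legal V x p}"
    unfolding stable by auto
  also have "\<dots> = {0, 1} \<times> legal V x p"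
    unfolding im using legal_subset by auto
  finally have "?f ` ?S = {0, 1} \<times> legal V x p" .
  moreover have "inj_on ?f ?S"
    by (rule inj_on_subset[OF bij_betw_imp_inj_on[OF bij_betw_colorings[OF R]]]) blast
  then have "card (?f ` ?S) = card ?S"
    by (rule card_image)
  ultimately have "card ?S = card ({0, 1 :: nat} \<times> legal V x p)"
    by simp
  then show ?thesis
    by (simp add: card_cartesian_product)
qed

text \<open>
  Every branching vertex \<open>v\<close> has an edge to a child \<open>g v\<close> that is not a leaf. The edges chosen
  for branching vertices whose depths have the same parity form a matching.
\<close>

lemma card_legal_ge_power:
  fixes K :: "'a set"
  defines "K \<equiv> {v \<in> V. 2 \<le> card (neighbors V x p v)}"
  defines "r \<equiv> card {v \<in> K. 2 \<le> card (neighbors V x p v \<inter> K)}"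
  shows "2 powr (real r / 2) \<le> real (card (legal V x p))"
proof -
  define I where "I = {v \<in> K. 2 \<le> card (neighbors V x p v \<inter> K)}"
  have IV: "I \<subseteq> V"
    by (auto simp: I_def K_def)
  then have fI: "finite I"
    using finite_V finite_subset by blast
  \<comment> \<open>Of two neighbors in \<open>K\<close> at most one is the parent, so some child
    lies in \<open>K\<close>.\<close>
  have "\<exists>u. u \<in> children V x p v \<inter> K" if "v \<in> I" for v
  proof (rule ccontr)
    assume "\<nexists>u. u \<in> children V x p v \<inter> K"
    then have "neighbors V x p v \<inter> K \<subseteq> {p v}"
      by (auto simp: neighbors_def split: if_splits)
    then have "card (neighbors V x p v \<inter> K) \<le> card {p v}"
      by (intro card_mono) auto
    then show False
      using that by (simp add: I_def)
  qed
  then obtain g where g: "\<And>v. v \<in> I \<Longrightarrow> g v \<in> children V x p v \<inter> K"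
    by metis
  have gV: "g v \<in> V - {x}" "p (g v) = v" "d (g v) = Suc (d v)" if "v \<in> I" for v
    using g[OF that] depth_parent by (auto simp: children_def)
  \<comment> \<open>The larger of the two parity classes contains at least half of
    \<open>I\<close>.\<close>
  have "r = card {v \<in> I. even (d v)} + card {v \<in> I. odd (d v)}"
    unfolding r_def I_def[symmetric]
    using fI by (subst card_Un_disjoint[symmetric]) (auto intro: arg_cong[where f = card])
  then obtain P where P: "P \<subseteq> I" "\<And>u v. u \<in> P \<Longrightarrow> v \<in> P \<Longrightarrow> even (d u) \<longleftrightarrow> even (d v)"
    "r \<le> 2 * card P"
  proof (cases "card {v \<in> I. even (d v)} \<le> card {v \<in> I. odd (d v)}")
    case True
    then show ?thesis
      using \<open>r = _\<close> by (intro that[of "{v \<in> I. odd (d v)}"]) auto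
  next
    case False
    then show ?thesis
      using \<open>r = _\<close> by (intro that[of "{v \<in> I. even (d v)}"]) auto
  qed
  have fP: "finite P"
    using P(1) fI finite_subset by blast
  have inj: "inj_on g P"
    using gV(2) P(1) by (intro inj_on_inverseI[of _ p]) auto
  have "g ` S \<in> legal V x p" if S: "S \<subseteq> P" for S
  proof (rule matching_legal)
    show "g ` S \<subseteq> V - {x}"
      using gV(1) S P(1) by auto
    show "inj_on p (g ` S)"
      using gV(2) S P(1) by (intro inj_onI) (auto simp: subset_iff)
    show "p v \<notin> g ` S" if v: "v \<in> g ` S" for v
    proof
      assume pv: "p v \<in> g ` S"
      from v obtain u where u: "u \<in> S" "v = g u" by blast
      from pv obtain w where w: "w \<in> S" "p v = g w" by blast
      \<comment> \<open>If the edge chosen for \<open>u\<close> continued that for \<open>w\<close>,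
        their depths would differ by one, against equal parity.\<close>
      have "u \<in> I" "w \<in> I" "u \<in> P" "w \<in> P" using u w S P(1) by auto
      then have "d u = Suc (d w)"
        using u w gV(2)[of u] gV(3)[of w] by auto
      then show False
        using P(2)[of u w] \<open>u \<in> P\<close> \<open>w \<in> P\<close> by auto
    qed
    show "2 \<le> card (neighbors V x p v) \<and> 2 \<le> card (neighbors V x p (p v))"
      if "v \<in> g ` S" for v
    proof -
      from that obtain u where "u \<in> I" "v = g u"
        using S P(1) by blast
      then show ?thesis
        using g[of u] gV(2)[of u] by (auto simp: I_def K_def)
    qed
  qed
  then have "(`) g ` Pow P \<subseteq> legal V x p"
    by auto
  then have "card ((`) g ` Pow P) \<le> card (legal V x p)"
    by (rule card_mono[OF finite_legal])
  also have "card ((`) g ` Pow P) = 2 ^ card P"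
    using card_image[OF inj_on_image_Pow[OF inj]] card_Pow[OF fP] by simp
  finally have le: "2 ^ card P \<le> card (legal V x p)" .
  have "2 powr (real r / 2) \<le> 2 powr real (card P)"
    using P(3) by simp
  also have "\<dots> = real (2 ^ card P)"
    by (simp add: powr_realpow)
  also have "\<dots> \<le> real (card (legal V x p))"
    using le by (rule of_nat_mono)
  finally show ?thesis .
qed

end

section \<open>Matchings on a path and the Fibonacci lower bound\<close>

text \<open>Splitting by whether the largest index is chosen, which excludes the one before it,
  yields the Fibonacci recurrence.\<close>

lemma fib_le_card_sparse_sets:
  "fib (m + 2) \<le> card {S. S \<subseteq> {..<m} \<and> (\<forall>i\<in>S. Suc i \<notin> S)}"
proof (induction m rule: fib.induct)
  case 1
  have "{S. S \<subseteq> {..<0::nat} \<and> (\<forall>i\<in>S. Suc i \<notin> S)} = {{}}"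
    by auto
  then show ?case by simp
next
  case 2
  have "{{}, {0}} \<subseteq> {S. S \<subseteq> {..<Suc 0} \<and> (\<forall>i\<in>S. Suc i \<notin> S)}"
    by auto
  then have "card {{}, {0::nat}} \<le> card {S. S \<subseteq> {..<Suc 0} \<and> (\<forall>i\<in>S. Suc i \<notin> S)}"
    by (intro card_mono) auto
  then show ?case by (simp add: numeral_2_eq_2 numeral_3_eq_3)
next
  case (3 m)
  let ?A = "\<lambda>m. {S. S \<subseteq> {..<m} \<and> (\<forall>i\<in>S. Suc i \<notin> S)}"
  have fin: "finite (?A m)" for m
    by (rule finite_subset[of _ "Pow {..<m}"]) auto
  have notin: "Suc m \<notin> S" if "S \<in> ?A (Suc m)" for S
    using that by auto
  have notin': "Suc m \<notin> S" if "S \<in> ?A m" for S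
    using that by auto
  have inj: "inj_on (insert (Suc m)) (?A m)"
    by (rule inj_on_inverseI[of _ "\<lambda>S. S - {Suc m}"]) (use notin' in \<open>simp del: insert_Diff_single\<close>)
  have "fib (Suc (Suc m) + 2) = fib (Suc m + 2) + fib (m + 2)"
    by simp
  also have "\<dots> \<le> card (?A (Suc m)) + card (?A m)"
    using 3 by simp
  also have "\<dots> = card (?A (Suc m) \<union> insert (Suc m) ` ?A m)"
    using fin notin by (subst card_Un_disjoint) (auto simp: card_image[OF inj])
  also have "\<dots> \<le> card (?A (Suc (Suc m)))"
    by (intro card_mono fin) (auto simp: less_Suc_eq)
  finally show ?case .
qed

context rooted_tree
begin

text \<open>On the path from \<open>x\<close> down to \<open>w\<close>, the first and last edges are
  left out because they may touch leaves. The sparse subsets of the remaining \<open>d w - 2\<close>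
  edges are legal matchings.\<close>

lemma card_legal_ge_fib:
  assumes x0: "d x = 0" and w: "w \<in> V"
  shows "fib (d w) \<le> card (legal V x p)"
proof -
  \<comment> \<open>\<open>q i\<close> is the vertex at depth \<open>i\<close> on the path to
    \<open>w\<close>.\<close>
  define q where "q i = (p ^^ (d w - i)) w" for i
  have qp: "(p ^^ k) w \<in> V \<and> d ((p ^^ k) w) = d w - k" if "k \<le> d w" for k
    using that
  proof (induction k)
    case (Suc k)
    then have "(p ^^ k) w \<in> V - {x}"
      using x0 by auto
    then show ?case
      using Suc parent_in depth_parent[of "(p ^^ k) w"] by auto
  qed (use w in auto)
  have q: "q i \<in> V" "d (q i) = i" if "i \<le> d w" for i
    using qp[of "d w - i"] that by (auto simp: q_def)
  have pq: "p (q (Suc i)) = q i" if "i < d w" for i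
    using that by (simp add: q_def Suc_diff_Suc flip: funpow.simps(2)[unfolded comp_def, THEN fun_cong])
  have qx: "q i \<noteq> x" if "0 < i" "i \<le> d w" for i
    using q(2)[OF that(2)] that x0 by auto
  have deg: "2 \<le> card (neighbors V x p (q i))" if i: "0 < i" "i < d w" for i
  proof -
    have "{p (q i), q (Suc i)} \<subseteq> neighbors V x p (q i)"
      using i q[of "Suc i"] qx[of i] qx[of "Suc i"] pq[of i] by (auto simp: neighbors_def children_def)
    then have "card {p (q i), q (Suc i)} \<le> card (neighbors V x p (q i))"
      by (rule card_mono[OF finite_neighbors])
    moreover have "d (p (q i)) < d (q (Suc i))"
      using i depth_parent[of "q i"] q[of i] q(2)[of "Suc i"] qx[of i] by simp
    then have "p (q i) \<noteq> q (Suc i)"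
      by auto
    ultimately show ?thesis by simp
  qed
  consider "d w = 0" | "d w = 1" | "2 \<le> d w"
    by linarith
  then show ?thesis
  proof cases
    case 2
    have "{} \<in> legal V x p"
      by (simp add: legal_def)
    then have "0 < card (legal V x p)"
      using finite_legal card_gt_0_iff by blast
    then show ?thesis
      using 2 by simp
  next
    case 3
    then obtain m where m: "d w = m + 2"
      by (metis le_add_diff_inverse2)
    let ?A = "{S. S \<subseteq> {..<m} \<and> (\<forall>i\<in>S. Suc i \<notin> S)}"
    \<comment> \<open>The offset 2 skips the edge at the root: \<open>?g i\<close> is the lower end
      of the edge between depths \<open>i + 1\<close> and \<open>i + 2\<close>.\<close>
    let ?g = "\<lambda>i. q (i + 2)"
    have dg: "d (?g i) = i + 2" "p (?g i) = q (Suc i)" "d (q (Suc i)) = Suc i" if "i < m" for i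
      using that q(2) pq[of "Suc i"] m by auto
    have inj: "inj_on ?g {..<m}"
      using dg(1) by (intro inj_on_inverseI[of _ "\<lambda>v. d v - 2"]) auto
    have "?g ` S \<in> legal V x p" if S: "S \<subseteq> {..<m}" "\<forall>i\<in>S. Suc i \<notin> S" for S
    proof (rule matching_legal)
      show "?g ` S \<subseteq> V - {x}"
      proof (rule image_subsetI)
        fix i assume "i \<in> S"
        then show "?g i \<in> V - {x}"
          using S(1) m q(1)[of "i + 2"] qx[of "i + 2"] by auto
      qed
      show "inj_on p (?g ` S)"
      proof (rule inj_onI)
        fix u v assume "u \<in> ?g ` S" "v \<in> ?g ` S" and eq: "p u = p v"
        then obtain i j where ij: "i < m" "j < m" "u = ?g i" "v = ?g j"
          using S by blast
        then have "Suc i = Suc j"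
          using eq dg(2,3)[of i] dg(2,3)[of j] by simp
        then show "u = v"
          using ij by simp
      qed
      show "p v \<notin> ?g ` S" if v: "v \<in> ?g ` S" for v
      proof
        assume "p v \<in> ?g ` S"
        then obtain j where j: "j \<in> S" "j < m" "p v = ?g j"
          using S by blast
        obtain i where i: "i \<in> S" "i < m" "v = ?g i"
          using v S by blast
        have "d (p v) = Suc i"
          unfolding i(3) dg(2)[OF i(2)] by (rule dg(3)[OF i(2)])
        moreover have "d (p v) = j + 2"
          unfolding j(3) by (rule dg(1)[OF j(2)])
        ultimately have "i = Suc j"
          by simp
        then show False
          using bspec[OF S(2) j(1)] i(1) by simp
      qed
      show "2 \<le> card (neighbors V x p v) \<and> 2 \<le> card (neighbors V x p (p v))"
        if "v \<in> ?g ` S" for v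
      proof -
        from that obtain i where i: "i < m" "v = ?g i"
          using S(1) by blast
        then show ?thesis
          using deg[of "i + 2"] deg[of "Suc i"] dg(2)[of i] m by simp
      qed
    qed
    then have sub: "(`) ?g ` ?A \<subseteq> legal V x p"
      by auto
    have "fib (d w) \<le> card ?A"
      using fib_le_card_sparse_sets[of m] m by simp
    also have "\<dots> = card ((`) ?g ` ?A)"
      by (intro card_image[symmetric] inj_on_subset[OF inj_on_image_Pow[OF inj]]) blast
    also have "\<dots> \<le> card (legal V x p)"
      by (rule card_mono[OF finite_legal sub])
    finally show ?thesis .
  qed simp
qed

end

section \<open>Rooting an undirected tree\<close>

text \<open>Replace each arc by its opposite. The vertex set is tracked so that a walk avoiding a
  vertex still avoids it when reversed.\<close>

lemma (in graph) awalk_reverse: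
  assumes "awalk u q v"
  shows "\<exists>q'. awalk v q' u \<and> set (awalk_verts v q') = set (awalk_verts u q)"
  using assms
proof (induction q arbitrary: u)
  case Nil
  then show ?case
    by (intro exI[of _ "[]"]) (auto simp: awalk_Nil_iff)
next
  case (Cons e q)
  then have e: "e \<in> arcs G" "u = tail G e" and q: "awalk (head G e) q v"
    by (auto simp: awalk_Cons_iff)
  obtain q' where q': "awalk v q' (head G e)"
    "set (awalk_verts v q') = set (awalk_verts (head G e) q)"
    using Cons.IH[OF q] by blast
  obtain e' where e': "e' \<in> arcs G" "tail G e' = head G e" "head G e' = u"
    using sym_arcs e by (auto simp: symmetric_conv)
  have w: "awalk (head G e) [e'] u"
    using arc_implies_awalk[OF e'(1)] e' by simp
  have "set (awalk_verts v (q' @ [e'])) = set (awalk_verts u (e # q))"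
    using q'(2) e(2) e'(2,3) hd_in_awalk_verts(1)[OF q] by (subst set_awalk_verts_append[OF q'(1) w]) auto
  then show ?case
    using awalk_appendI[OF q'(1) w] by blast
qed

text \<open>An arc \<open>v u\<^sub>1\<close>, a path from \<open>u\<^sub>1\<close> to \<open>u\<^sub>2\<close> and the arc \<open>u\<^sub>2 v\<close> form a cycle.\<close>

lemma undirected_tree_neighbors_separated:
  assumes T: "undirected_tree G" and adj: "v \<rightarrow>\<^bsub>G\<^esub> u\<^sub>1" "v \<rightarrow>\<^bsub>G\<^esub> u\<^sub>2"
    and q: "pre_digraph.awalk G u\<^sub>1 q u\<^sub>2" and v: "v \<notin> set (pre_digraph.awalk_verts G u\<^sub>1 q)"
  shows "u\<^sub>1 = u\<^sub>2"
proof (rule ccontr)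
  assume neq: "u\<^sub>1 \<noteq> u\<^sub>2"
  interpret graph G
    using T by (simp add: undirected_tree_def)
  \<comment> \<open>Shortening to a path makes the vertices distinct, and using only arcs of
    \<open>q\<close> it still avoids \<open>v\<close>.\<close>
  define q' where "q' = awalk_to_apath q"
  have q': "apath u\<^sub>1 q' u\<^sub>2"
    unfolding q'_def by (rule apath_awalk_to_apath[OF q])
  then have w: "awalk u\<^sub>1 q' u\<^sub>2" and dist: "distinct (awalk_verts u\<^sub>1 q')"
    by (auto simp: apath_def)
  have "set q' \<subseteq> set q"
    unfolding q'_def by (rule awalk_to_apath_subset[OF q])
  then have v': "v \<notin> set (awalk_verts u\<^sub>1 q')"
    using v by (auto simp: set_awalk_verts[OF w] set_awalk_verts[OF q])
  have "q' \<noteq> []"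
    using w neq by (auto simp: awalk_Nil_iff)
  obtain e\<^sub>1 where e1: "e\<^sub>1 \<in> arcs G" "tail G e\<^sub>1 = v" "head G e\<^sub>1 = u\<^sub>1"
    using adj(1) by auto
  obtain e\<^sub>2 where e2: "e\<^sub>2 \<in> arcs G" "tail G e\<^sub>2 = u\<^sub>2" "head G e\<^sub>2 = v"
    using graph_symmetric[OF adj(2)] by auto
  have w2: "awalk u\<^sub>2 [e\<^sub>2] v"
    using arc_implies_awalk[OF e2(1)] e2 by simp
  have w3: "awalk u\<^sub>1 (q' @ [e\<^sub>2]) v"
    by (rule awalk_appendI[OF w w2])
  have "awalk v (e\<^sub>1 # q' @ [e\<^sub>2]) v"
    using w3 e1 by (simp add: awalk_Cons_iff del: awalk_append_iff)
  moreover have "awalk_verts u\<^sub>1 (q' @ [e\<^sub>2]) = awalk_verts u\<^sub>1 q' @ [v]"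
    using awalk_verts_append[OF w3] e2 by simp
  then have "distinct (tl (awalk_verts v (e\<^sub>1 # q' @ [e\<^sub>2])))"
    using dist v' e1 by simp
  ultimately have "cycle (e\<^sub>1 # q' @ [e\<^sub>2])"
    unfolding cycle_def by blast
  moreover have "3 \<le> length (e\<^sub>1 # q' @ [e\<^sub>2])"
    using \<open>q' \<noteq> []\<close> by (cases q') auto
  ultimately show False
    using T unfolding undirected_tree_def by blast
qed

lemma distance_le: "pre_digraph.awalk G u q v \<Longrightarrow> distance G u v \<le> length q"
  unfolding distance_def by (rule Least_le) blast

text \<open>Connectedness speaks of the symmetric closure, which for a symmetric digraph has the
  same reachability; hence the minimum in \<open>distance\<close> is attained.\<close>

lemma undirected_tree_shortest_awalk:
  assumes "undirected_tree G" "u \<in> verts G" "v \<in> verts G"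
  obtains q where "pre_digraph.awalk G u q v" "length q = distance G u v"
proof -
  interpret graph G
    using assms(1) by (simp add: undirected_tree_def)
  have "u \<rightarrow>\<^sup>*\<^bsub>mk_symmetric G\<^esub> v"
    using assms by (simp add: undirected_tree_def connected_def strongly_connected_def)
  then have "\<exists>q. awalk u q v"
    by (simp add: reachable_mk_symmetric_eq[OF sym_arcs] reachable_awalk)
  then have "\<exists>k q. awalk u q v \<and> length q = k"
    by blast
  then have "\<exists>q. awalk u q v \<and> length q = distance G u v"
    unfolding distance_def by (rule LeastI_ex)
  then show ?thesis
    using that by blast
qed

text \<open>The part of the walk up to \<open>w\<close> is a proper initial segment.\<close>

lemma (in wf_digraph) distance_less_on_shortest:
  assumes q: "awalk x q u" "length q = distance G x u"
    and w: "w \<in> set (awalk_verts x q)" "w \<noteq> u"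
  shows "distance G x w < distance G x u"
proof -
  obtain a b where ab: "q = a @ b" "awalk x a w" "awalk w b u"
    using awalk_decomp[OF q(1) w(1)] by blast
  then have "b \<noteq> []"
    using w(2) by (auto simp: awalk_Nil_iff)
  then have "length a < length q"
    using ab(1) by simp
  then show ?thesis
    using distance_le[OF ab(2)] q(2) by simp
qed

text \<open>Shortest walks from \<open>x\<close> to both neighbors avoid \<open>v\<close>, which is
  no closer to \<open>x\<close> than they are; joined at \<open>x\<close> they connect the neighbors
  without \<open>v\<close>. The non-strict inequality also covers edges within one level.\<close>

lemma undirected_tree_parent_unique:
  assumes T: "undirected_tree G" and x: "x \<in> verts G"
    and adj: "v \<rightarrow>\<^bsub>G\<^esub> u\<^sub>1" "v \<rightarrow>\<^bsub>G\<^esub> u\<^sub>2"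
    and le: "distance G x u\<^sub>1 \<le> distance G x v" "distance G x u\<^sub>2 \<le> distance G x v"
  shows "u\<^sub>1 = u\<^sub>2"
proof -
  interpret graph G
    using T by (simp add: undirected_tree_def)
  have path: "\<exists>q. awalk x q u \<and> v \<notin> set (awalk_verts x q)"
    if u: "v \<rightarrow>\<^bsub>G\<^esub> u" "distance G x u \<le> distance G x v" for u
  proof -
    have "u \<in> verts G" "u \<noteq> v"
      using u(1) adj_not_same by auto
    obtain q where q: "awalk x q u" "length q = distance G x u"
      by (rule undirected_tree_shortest_awalk[OF T x \<open>u \<in> verts G\<close>])
    then show ?thesis
      using distance_less_on_shortest[OF q, of v] u(2) \<open>u \<noteq> v\<close> by auto
  qed
  obtain q\<^sub>1 where q1: "awalk x q\<^sub>1 u\<^sub>1" "v \<notin> set (awalk_verts x q\<^sub>1)"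
    using path[OF adj(1) le(1)] by blast
  obtain q\<^sub>2 where q2: "awalk x q\<^sub>2 u\<^sub>2" "v \<notin> set (awalk_verts x q\<^sub>2)"
    using path[OF adj(2) le(2)] by blast
  obtain r where r: "awalk u\<^sub>1 r x" "v \<notin> set (awalk_verts u\<^sub>1 r)"
    using awalk_reverse[OF q1(1)] q1(2) by auto
  have "v \<notin> set (awalk_verts u\<^sub>1 (r @ q\<^sub>2))"
    using set_awalk_verts_append[OF r(1) q2(1)] r(2) q2(2) by simp
  then show ?thesis
    by (rule undirected_tree_neighbors_separated[OF T adj awalk_appendI[OF r(1) q2(1)]])
qed

text \<open>The parent of \<open>v\<close> is its predecessor on a shortest walk from
  \<open>x\<close>. By uniqueness, of two adjacent vertices the one that is at least as far from
  \<open>x\<close> has the other as its parent.\<close>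

lemma undirected_tree_rooted:
  assumes T: "undirected_tree G" and x: "x \<in> verts G"
  obtains p where "rooted_tree (verts G) x p (distance G x)"
    "distance G x x = 0"
    "\<And>v. v \<in> verts G \<Longrightarrow> {u. v \<rightarrow>\<^bsub>G\<^esub> u} = neighbors (verts G) x p v"
proof -
  interpret graph G
    using T by (simp add: undirected_tree_def)
  let ?d = "distance G x"
  have dx: "?d x = 0"
    using distance_le[of G x "[]" x] x by (simp add: awalk_Nil_iff)
  have "\<exists>u. v \<rightarrow>\<^bsub>G\<^esub> u \<and> ?d v = Suc (?d u)" if v: "v \<in> verts G - {x}" for v
  proof -
    obtain q where q: "awalk x q v" "length q = ?d v"
      using undirected_tree_shortest_awalk[OF T x] v by blast
    have "q \<noteq> []"
      using q(1) v by (auto simp: awalk_Nil_iff)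
    then obtain a e where ae: "q = a @ [e]"
      by (cases q rule: rev_cases) auto
    then have e: "awalk x a (tail G e)" "e \<in> arcs G" "head G e = v"
      using q(1) by (auto simp: awalk_simps)
    obtain b where b: "awalk x b (tail G e)" "length b = ?d (tail G e)"
      by (rule undirected_tree_shortest_awalk[OF T x tail_in_verts[OF e(2)]])
    have "awalk x (b @ [e]) v"
      using awalk_appendI[OF b(1) arc_implies_awalk[OF e(2)]] e(3) by simp
    from distance_le[OF this] have "?d v \<le> Suc (?d (tail G e))"
      using b(2) by simp
    moreover have "Suc (?d (tail G e)) \<le> ?d v"
      using distance_le[OF e(1)] q(2) ae by simp
    moreover have "v \<rightarrow>\<^bsub>G\<^esub> tail G e"
      using in_arcs_imp_in_arcs_ends[OF e(2)] e(3) graph_symmetric by auto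
    ultimately show ?thesis
      by (intro exI[of _ "tail G e"]) simp
  qed
  then obtain p where p: "\<And>v. v \<in> verts G - {x} \<Longrightarrow> v \<rightarrow>\<^bsub>G\<^esub> p v"
    "\<And>v. v \<in> verts G - {x} \<Longrightarrow> ?d v = Suc (?d (p v))"
    by metis
  have parent: "u \<noteq> x \<and> p u = v" if adj: "u \<rightarrow>\<^bsub>G\<^esub> v" and le: "?d v \<le> ?d u" for u v
  proof -
    have uv: "u \<in> verts G" "v \<in> verts G" "u \<noteq> v"
      using adj adj_not_same by auto
    have "u \<noteq> x"
    proof
      assume "u = x"
      then have "v \<noteq> x" "?d v = 0"
        using le dx uv by auto
      then show False
        using p(2)[of v] uv by simp
    qed
    moreover from this have "p u = v"
      using undirected_tree_parent_unique[OF T x p(1) adj] p(2)[of u] le uv by simp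
    ultimately show ?thesis by simp
  qed
  show ?thesis
  proof
    show "rooted_tree (verts G) x p ?d"
    proof
      show "p v \<in> verts G" if "v \<in> verts G - {x}" for v
        using p(1)[OF that] by (rule adj_in_verts)
    qed (use x p(2) in auto)
    show "?d x = 0"
      by (rule dx)
    show "{u. v \<rightarrow>\<^bsub>G\<^esub> u} = neighbors (verts G) x p v" if v: "v \<in> verts G" for v
    proof (intro set_eqI iffI)
      fix u assume "u \<in> {u. v \<rightarrow>\<^bsub>G\<^esub> u}"
      then have adj: "v \<rightarrow>\<^bsub>G\<^esub> u" by simp
      then have "u \<in> verts G" by auto
      show "u \<in> neighbors (verts G) x p v"
      proof (cases "?d u \<le> ?d v")
        case True
        then show ?thesis
          using parent[OF adj] by (simp add: neighbors_def)
      next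
        case False
        then show ?thesis
          using parent[OF graph_symmetric[OF adj]] \<open>u \<in> verts G\<close>
          by (simp add: neighbors_def children_def)
      qed
    next
      fix u assume "u \<in> neighbors (verts G) x p v"
      then show "u \<in> {u. v \<rightarrow>\<^bsub>G\<^esub> u}"
        using p(1)[of v] p(1)[of u] graph_symmetric[of u v] v
        by (auto simp: neighbors_def children_def split: if_splits)
    qed
  qed
qed

section \<open>Degrees, inner nodes and fixed points in terms of neighbor sets\<close>

lemma (in nomulti_digraph) inj_on_head_out_arcs: "inj_on (head G) (out_arcs G v)"
  using no_multi_arcs by (intro inj_onI) (auto simp: out_arcs_def arc_to_ends_def)

lemma (in nomulti_digraph) out_degree_eq_card: "out_degree G v = card {u. v \<rightarrow>\<^bsub>G\<^esub> u}"
proof -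
  have "head G ` out_arcs G v = {u. v \<rightarrow>\<^bsub>G\<^esub> u}"
    by (auto simp: out_arcs_def arcs_ends_conv)
  then show ?thesis
    using card_image[OF inj_on_head_out_arcs[of v]] by (simp add: out_degree_def)
qed

lemma (in nomulti_digraph) out_degree_induce_subgraph:
  assumes "v \<in> S"
  shows "out_degree (G \<restriction> S) v = card ({u. v \<rightarrow>\<^bsub>G\<^esub> u} \<inter> S)"
proof -
  have "out_arcs (G \<restriction> S) v \<subseteq> out_arcs G v"
    by (auto simp: out_arcs_def)
  then have "card (head G ` out_arcs (G \<restriction> S) v) = out_degree (G \<restriction> S) v"
    unfolding out_degree_def by (intro card_image inj_on_subset[OF inj_on_head_out_arcs])
  moreover have "head G ` out_arcs (G \<restriction> S) v = {u. v \<rightarrow>\<^bsub>G\<^esub> u} \<inter> S"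
    using assms by (auto simp: out_arcs_def arcs_ends_conv)
  ultimately show ?thesis by simp
qed

lemma (in graph) inner_nodes_remove_leaves:
  fixes N :: "'a \<Rightarrow> 'a set"
  assumes N: "\<And>v. v \<in> verts G \<Longrightarrow> {u. v \<rightarrow>\<^bsub>G\<^esub> u} = N v"
  defines "K \<equiv> {v \<in> verts G. 2 \<le> card (N v)}"
  shows "inner_nodes (remove_leaves G) = {v \<in> K. 2 \<le> card (N v \<inter> K)}"
proof -
  have deg: "out_degree G v = card (N v)" if "v \<in> verts G" for v
    using out_degree_eq_card[of v] N[OF that] by simp
  have sub: "N v \<subseteq> verts G" if "v \<in> verts G" for v
    using N[OF that] adj_in_verts(2) by blast
  have fin: "finite (N v)" if "v \<in> verts G" for v
    using sub[OF that] finite_verts by (rule finite_subset)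
  let ?L = "verts G - leaves G"
  have "N v \<inter> ?L = N v \<inter> K" if v: "v \<in> verts G" for v
  proof -
    \<comment> \<open>A neighbor of \<open>v\<close> has positive degree, so not being a leaf means
      degree at least 2.\<close>
    have "u \<in> ?L \<longleftrightarrow> u \<in> K" if "u \<in> N v" for u
    proof -
      have u: "u \<in> verts G"
        using sub[OF v] that by blast
      have "v \<rightarrow>\<^bsub>G\<^esub> u"
        using N[OF v] that by blast
      then have "v \<in> N u"
        using N[OF u] graph_symmetric by blast
      then have "card (N u) \<noteq> 0"
        using fin[OF u] by auto
      then show ?thesis
        using u deg[OF u] by (auto simp: leaves_def K_def)
    qed
    then show ?thesis by blast
  qed
  then have "inner_nodes (remove_leaves G) = {v \<in> ?L. 2 \<le> card (N v \<inter> K)}"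
    using N by (auto simp: inner_nodes_def remove_leaves_def out_degree_induce_subgraph)
  \<comment> \<open>An isolated vertex lies in \<open>?L\<close> but not in \<open>K\<close>; the
    degree condition excludes it.\<close>
  also have "\<dots> = {v \<in> K. 2 \<le> card (N v \<inter> K)}"
  proof -
    have "card (N v \<inter> K) \<le> card (N v)" if "v \<in> verts G" for v
      using fin[OF that] by (rule card_mono) simp
    then show ?thesis
      using deg by (fastforce simp: leaves_def K_def)
  qed
  finally show ?thesis .
qed

text \<open>A vertex keeps its color iff the neighbors to avoid do not outnumber the others. The two
  groups add up to the degree, so this means at most half of it.\<close>

lemma (in fin_digraph) fixed_points_eq:
  fixes N :: "'a \<Rightarrow> 'a set" and R :: "nat \<Rightarrow> nat \<Rightarrow> bool"
  assumes N: "\<And>v. v \<in> verts G \<Longrightarrow> {u. v \<rightarrow>\<^bsub>G\<^esub> u} = N v"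
    and M: "(M = minority G \<and> R = (=)) \<or> (M = majority G \<and> R = (\<noteq>))"
  shows "fixed_points G M = {c \<in> verts G \<rightarrow>\<^sub>E {0, 1}. \<forall>v\<in>verts G.
    2 * card {u \<in> N v. R (c u) (c v)} \<le> card (N v)}"
proof -
  have "M c = c \<longleftrightarrow> (\<forall>v\<in>verts G. 2 * card {u \<in> N v. R (c u) (c v)} \<le> card (N v))"
    if c: "c \<in> verts G \<rightarrow>\<^sub>E {0, 1}" for c
  proof -
    let ?same = "\<lambda>v. card (colored_neighbors G c (c v) v)"
    let ?diff = "\<lambda>v. card (colored_neighbors G c (1 - c v) v)"
    have c_ext: "c \<in> extensional (verts G)"
      using c by (simp add: PiE_def)
    have ext: "restrict f (verts G) = c \<longleftrightarrow> (\<forall>v\<in>verts G. f v = c v)" for f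
    proof
      assume "\<forall>v\<in>verts G. f v = c v"
      then show "restrict f (verts G) = c"
        by (intro extensionalityI[OF restrict_extensional c_ext]) simp
    qed auto
    have col: "c v = 0 \<or> c v = 1" if "v \<in> verts G" for v
      using PiE_mem[OF c that] by simp
    have flip: "1 - c v \<noteq> c v" if "v \<in> verts G" for v
      using col[OF that] by auto
    have sub: "N v \<subseteq> verts G" if "v \<in> verts G" for v
      using N[OF that] adj_in_verts(2) by blast
    have same: "colored_neighbors G c (c v) v = {u \<in> N v. c u = c v}" if v: "v \<in> verts G" for v
      using N[OF v] sub[OF v] by (auto simp: colored_neighbors_def)
    have diff: "colored_neighbors G c (1 - c v) v = {u \<in> N v. c u \<noteq> c v}" if v: "v \<in> verts G" for v
    proof -
      have "c u = 1 - c v \<longleftrightarrow> c u \<noteq> c v" if "u \<in> verts G" for u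
        using col[OF v] col[OF that] by (elim disjE) simp_all
      then show ?thesis
        using N[OF v] sub[OF v] by (auto simp: colored_neighbors_def)
    qed
    have total: "card {u \<in> N v. c u = c v} + card {u \<in> N v. c u \<noteq> c v} = card (N v)"
      if v: "v \<in> verts G" for v
    proof -
      have "finite (N v)"
        using sub[OF v] finite_verts by (rule finite_subset)
      then show ?thesis
        by (subst card_Un_disjoint[symmetric]) (auto intro: arg_cong[where f = card])
    qed
    have "minority G c = c \<longleftrightarrow> (\<forall>v\<in>verts G. ?same v \<le> ?diff v)"
      unfolding minority_def ext using flip by auto
    moreover have "majority G c = c \<longleftrightarrow> (\<forall>v\<in>verts G. ?diff v \<le> ?same v)"
      unfolding majority_def ext using flip by auto
    moreover have "?same v \<le> ?diff v \<longleftrightarrow> 2 * card {u \<in> N v. c u = c v} \<le> card (N v)"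
      "?diff v \<le> ?same v \<longleftrightarrow> 2 * card {u \<in> N v. c u \<noteq> c v} \<le> card (N v)"
      if v: "v \<in> verts G" for v
      unfolding same[OF v] diff[OF v] using total[OF v] by linarith+
    ultimately show ?thesis
      using M by auto
  qed
  then show ?thesis
    by (auto simp: fixed_points_def colorings_def)
qed

text \<open>The root stays free, since the bounds call for different ones: a vertex of maximal
  degree or an end of a longest path.\<close>

lemma undirected_tree_card_fixed_points:
  assumes T: "undirected_tree G" and M: "M = minority G \<or> M = majority G"
    and x: "x \<in> verts G"
  obtains p where "rooted_tree (verts G) x p (distance G x)"
    "distance G x x = 0"
    "\<And>v. v \<in> verts G \<Longrightarrow> {u. v \<rightarrow>\<^bsub>G\<^esub> u} = neighbors (verts G) x p v"
    "card (fixed_points G M) = 2 * card (legal (verts G) x p)"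
proof -
  interpret graph G
    using T by (simp add: undirected_tree_def)
  obtain p where p: "rooted_tree (verts G) x p (distance G x)" "distance G x x = 0"
    and N: "\<And>v. v \<in> verts G \<Longrightarrow> {u. v \<rightarrow>\<^bsub>G\<^esub> u} = neighbors (verts G) x p v"
    by (rule undirected_tree_rooted[OF T x]) (rule that)
  obtain R :: "nat \<Rightarrow> nat \<Rightarrow> bool"
    where R: "(M = minority G \<and> R = (=)) \<or> (M = majority G \<and> R = (\<noteq>))"
    using M by blast
  have "card (fixed_points G M) = 2 * card (legal (verts G) x p)"
    using fixed_points_eq[OF N R] rooted_tree.card_stable_colorings[OF p(1), of R] R by auto
  from that[OF p N this] show ?thesis .
qed

lemma undirected_tree_nonempty: "undirected_tree G \<Longrightarrow> verts G \<noteq> {}"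
  by (auto simp: undirected_tree_def connected_def strongly_connected_def)

section \<open>The bounds on the number of fixed points\<close>

lemma card_fixed_points_le:
  assumes T: "undirected_tree G" and M: "M = minority G \<or> M = majority G"
  defines "n \<equiv> card (verts G)" and "\<Delta> \<equiv> max_degree G"
  shows "card (fixed_points G M) \<le> min (2 ^ (n - \<Delta>)) (2 * fib (n - nat \<lceil>real \<Delta> / 2\<rceil>))"
proof -
  interpret graph G
    using T by (simp add: undirected_tree_def)
  have "\<Delta> \<in> out_degree G ` verts G"
    unfolding \<Delta>_def max_degree_def using undirected_tree_nonempty[OF T] by (intro Max_in) auto
  then obtain x where x: "x \<in> verts G" "out_degree G x = \<Delta>"
    by auto
  obtain p where p: "rooted_tree (verts G) x p (distance G x)"
    and N: "\<And>v. v \<in> verts G \<Longrightarrow> {u. v \<rightarrow>\<^bsub>G\<^esub> u} = neighbors (verts G) x p v"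
    and card: "card (fixed_points G M) = 2 * card (legal (verts G) x p)"
    by (rule undirected_tree_card_fixed_points[OF T M x(1)]) (rule that)
  interpret rooted_tree "verts G" x p "distance G x"
    by (rule p)
  have deg: "card (children (verts G) x p x) = \<Delta>"
    using x(2) out_degree_eq_card[of x] N[OF x(1)] by (simp add: neighbors_def)
  have half: "nat \<lceil>real \<Delta> / 2\<rceil> = \<Delta> - \<Delta> div 2"
    by linarith
  \<comment> \<open>Strictness keeps \<open>n - 1 - \<Delta>\<close> from being truncated, so the
    factor 2 raises the exponent by exactly one.\<close>
  have "\<Delta> < n"
    using card_children_root_less by (simp add: deg n_def)
  then have "2 * (2 :: nat) ^ (n - 1 - \<Delta>) = 2 ^ (n - \<Delta>)"
    by (simp flip: power_Suc add: Suc_diff_Suc)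
  then show ?thesis
    using card_legal_le by (auto simp: card deg half n_def)
qed

lemma card_fixed_points_ge_power:
  assumes T: "undirected_tree G" and M: "M = minority G \<or> M = majority G"
  shows "2 powr (real (card (inner_nodes (remove_leaves G))) / 2 + 1)
    \<le> real (card (fixed_points G M))"
proof -
  interpret graph G
    using T by (simp add: undirected_tree_def)
  obtain x where x: "x \<in> verts G"
    using undirected_tree_nonempty[OF T] by blast
  obtain p where p: "rooted_tree (verts G) x p (distance G x)"
    and N: "\<And>v. v \<in> verts G \<Longrightarrow> {u. v \<rightarrow>\<^bsub>G\<^esub> u} = neighbors (verts G) x p v"
    and card: "card (fixed_points G M) = 2 * card (legal (verts G) x p)"
    by (rule undirected_tree_card_fixed_points[OF T M x]) (rule that)
  show ?thesis
    using rooted_tree.card_legal_ge_power[OF p]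
    by (simp add: card inner_nodes_remove_leaves[OF N] powr_add)
qed

text \<open>Rooting at one end of a pair at maximal distance puts the other end at depth
  \<open>diameter G\<close>.\<close>

lemma card_fixed_points_ge_fib:
  assumes T: "undirected_tree G" and M: "M = minority G \<or> M = majority G"
  shows "2 * fib (diameter G) \<le> card (fixed_points G M)"
proof -
  interpret graph G
    using T by (simp add: undirected_tree_def)
  have "{distance G u v | u v. u \<in> verts G \<and> v \<in> verts G}
      = (\<lambda>(u, v). distance G u v) ` (verts G \<times> verts G)"
    by auto
  then have "diameter G \<in> (\<lambda>(u, v). distance G u v) ` (verts G \<times> verts G)"
    unfolding diameter_def using undirected_tree_nonempty[OF T]
    by (simp only:) (intro Max_in, auto)
  then obtain x w where x: "x \<in> verts G" and w: "w \<in> verts G" "diameter G = distance G x w"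
    by auto
  obtain p where p: "rooted_tree (verts G) x p (distance G x)" "distance G x x = 0"
    and card: "card (fixed_points G M) = 2 * card (legal (verts G) x p)"
    by (rule undirected_tree_card_fixed_points[OF T M x]) (rule that)
  show ?thesis
    using rooted_tree.card_legal_ge_fib[OF p w(1)] by (simp add: card w(2))
qed

theorem theorem2:
  fixes G :: "('a, 'b) pre_digraph"
    and M :: "('a \<Rightarrow> nat) \<Rightarrow> ('a \<Rightarrow> nat)"
    and n D \<Delta> r :: nat
  assumes "undirected_tree G"
    and "M = minority G \<or> M = majority G"
    and "n = card (verts G)"
    and "D = diameter G"
    and "\<Delta> = max_degree G"
    and "r = card (inner_nodes (remove_leaves G))"
  shows "max (2 powr (real r / 2 + 1)) (2 * real (fib D)) \<le> real (card (fixed_points G M))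
    \<and> card (fixed_points G M) \<le> min (2 ^ (n - \<Delta>)) (2 * fib (n - nat \<lceil>real \<Delta> / 2\<rceil>))"
proof -
  have "2 * real (fib D) \<le> real (card (fixed_points G M))"
    using of_nat_mono[OF card_fixed_points_ge_fib[OF assms(1,2)]] by (simp add: assms(4))
  then show ?thesis
    using card_fixed_points_ge_power[OF assms(1,2)] card_fixed_points_le[OF assms(1,2)]
    by (simp only: assms(3,5,6) max.bounded_iff)
qed

end
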